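(* If $(p^{A\vee},p^{A\wedge},e^{S\downarrow},e^{S\uparrow})$ is feasible in the Rectangular model, then $(p^{A\vee},p^{A\wedge})$ is feasible in the Multistage model. Furthermore, the optimal value of the Rectangular model is less than or equal to the optimal value of the Multistage model.
   Context: **Distribution system.** $T\ge 1$ is an integer, $S_T=\{1,\dots,T\}$, $\tau>0$. $S_N$ is a finite set of nodes containing node $1$; $S_D,S_G,S_S\subseteq S_N$ are the sets of loads, generators and energy storage systems (ESSs). For each period $t$ the variables are $p_t^A\in\mathbb{R}$ (aggregate power), $p_t^S=(p_{it}^S)_{i\in S_S}$, $e_t^S=(e_{it}^S)_{i\in S_S}$ (stored energy), and $y_t=(p_{it}^D,q_{it}^D,p_{it}^G,q_{it}^G,q_{it}^S,p_{it}^N,q_{it}^N)_{i\in S_N}$; quantities of a device type not present at node $i$ are $0$. Real data are given: $\underline P_{it}^D,\overline P_{it}^D,\eta_{it}^D,\underline P_{it}^G,\overline P_{it}^G,\overline S_{it}^G,\overline S_i^S,\underline E_i^S,\overline E_i^S$, with $\overline P_i^{SD},\overline P_i^{SC}>0$, $\kappa_i^S,\eta_i^{SD},\eta_i^{SC}\in(0,1]$, a convex set $C_N$, and a given initial stored energy $e_0^S=(e_{i0}^S)_{i\in S_S}$. **The set $C_t$.** $C_t$ is the set of $(p_t^A,p_t^S,y_t)$ with: $\underline P_{it}^D\le p_{it}^D\le\overline P_{it}^D$ and $q_{it}^D=\eta_{it}^Dp_{it}^D$ for $i\in S_D$; $\underline P_{it}^G\le p_{it}^G\le\overline P_{it}^G$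 and $(p_{it}^G)^2+(q_{it}^G)^2\le(\overline S_{it}^G)^2$ for $i\in S_G$; $-\overline P_i^{SC}\le p_{it}^S\le\overline P_i^{SD}$ and $(p_{it}^S)^2+(q_{it}^S)^2\le(\overline S_i^S)^2$ for $i\in S_S$; $p_{it}^N=p_{it}^G+p_{it}^S-p_{it}^D$ and $q_{it}^N=q_{it}^G+q_{it}^S-q_{it}^D$ for $i\in S_N$; $p_t^A=p_{1t}^N$; $((p_{it}^N)_{i\in S_N},(q_{it}^N)_{i\in S_N})\in C_N$. It is assumed that $C_t$ is convex and closed. **Operational constraints.** Let $F_i(p)=\max\{p,0\}\tau/\eta_i^{SD}+\min\{p,0\}\tau\eta_i^{SC}$. $(\mathrm{OC}_t)$: $(p_t^A,p_t^S,y_t)\in C_t$; $e_{it}^S=\kappa_i^Se_{i(t-1)}^S-F_i(p_{it}^S)$ and $\underline E_i^S\le e_{it}^S\le\overline E_i^S$ for all $i\in S_S$. **Models.** $\phi:\mathbb{R}^T\times\mathbb{R}^T\to\mathbb{R}$ is a function; both models maximize $\phi(p^{A\vee},p^{A\wedge})$ and the optimal value is the supremum over the feasible set, in $[-\infty,\infty]$. *Multistage model:* $(p^{A\vee},p^{A\wedge})\in\mathbb{R}^T\times\mathbb{R}^T$ is feasible if $p_t^{A\vee}\le p_t^{A\wedge}$ for all $t\in S_T$ and $\forall p_1^A\in[p_1^{A\vee},p_1^{A\wedge}]\ \exists e_1^S,p_1^S,y_1\ \forall p_2^A\in[p_2^{A\vee},p_2^{A\wedge}]\ \exists e_2^S,p_2^S,y_2\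 \cdots\ \forall p_T^A\in[p_T^{A\vee},p_T^{A\wedge}]\ \exists e_T^S,p_T^S,y_T$ such that $(\mathrm{OC}_t)$ holds for all $t\in S_T$. *Rectangular model:* $(p^{A\vee},p^{A\wedge},e^{S\downarrow},e^{S\uparrow})$, with $e^{S\downarrow}=(e_{it}^{S\downarrow})$, $e^{S\uparrow}=(e_{it}^{S\uparrow})$ for $i\in S_S$, $t\in S_T\cup\{0\}$, is feasible if $p_t^{A\vee}\le p_t^{A\wedge}$ for all $t\in S_T$; $e_{i0}^{S\downarrow}\le e_{i0}^S\le e_{i0}^{S\uparrow}$ for all $i$; $\underline E_i^S\le e_{it}^{S\downarrow}\le e_{it}^{S\uparrow}\le\overline E_i^S$ for all $i\in S_S$, $t\in S_T\cup\{0\}$; and for all $t\in S_T$ and all $e_{t-1}^S\in\prod_{i\in S_S}[e_{i(t-1)}^{S\downarrow},e_{i(t-1)}^{S\uparrow}]$ there exist $e_t^{S\vee},p_t^{S\vee},y_t^\vee,e_t^{S\wedge},p_t^{S\wedge},y_t^\wedge$ with $(p_t^{A\vee},p_t^{S\vee},y_t^\vee),(p_t^{A\wedge},p_t^{S\wedge},y_t^\wedge)\in C_t$ and, for all $i\in S_S$, $e_{it}^{S\vee},e_{it}^{S\wedge}\in[e_{it}^{S\downarrow},e_{it}^{S\uparrow}]$, $e_{it}^{S\vee}=\kappa_i^Se_{i(t-1)}^S-F_i(p_{it}^{S\vee})$, $e_{it}^{S\wedge}=\kappa_i^Se_{i(t-1)}^S-F_i(p_{it}^{S\wedge})$. *)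

theory Defs
  imports "HOL-Analysis.Analysis"
begin

text \<open>
  The set of nodes is a finite type \<open>'n\<close>, whose distinguished element \<open>root\<close> is the node
  called 1.  Families indexed by loads, generators or storage systems are represented by vectors
  indexed by all nodes.  In a member of \<open>C_set\<close> the entries of absent devices are 0; the
  entries of \<open>e0\<close> and of all other stored-energy vectors outside \<open>storages\<close> are never used.
  Data with two indices take the node first and the period second.
\<close>

record ('n::finite) dist_system =
  horizon :: nat
  tau :: real
  root :: 'n
  loads :: "'n set"
  gens :: "'n set"
  storages :: "'n set"
  PD_lo :: "'n \<Rightarrow> nat \<Rightarrow> real"
  PD_hi :: "'n \<Rightarrow> nat \<Rightarrow> real"
  eta_D :: "'n \<Rightarrow> nat \<Rightarrow> real"
  PG_lo :: "'n \<Rightarrow> nat \<Rightarrow> real"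
  PG_hi :: "'n \<Rightarrow> nat \<Rightarrow> real"
  SG_hi :: "'n \<Rightarrow> nat \<Rightarrow> real"
  SS_hi :: "'n \<Rightarrow> real"
  PSD_hi :: "'n \<Rightarrow> real"
  PSC_hi :: "'n \<Rightarrow> real"
  E_lo :: "'n \<Rightarrow> real"
  E_hi :: "'n \<Rightarrow> real"
  kappa :: "'n \<Rightarrow> real"
  eta_SD :: "'n \<Rightarrow> real"
  eta_SC :: "'n \<Rightarrow> real"
  C_N :: "((real^'n) \<times> (real^'n)) set"
  e0 :: "real^'n"

text \<open>The components of \<open>y\<^sub>t\<close> are, in this order, pD, qD, pG, qG, qS, pN, qN.\<close>

type_synonym 'n node_vars =
  "(real^'n) \<times> (real^'n) \<times> (real^'n) \<times> (real^'n) \<times> (real^'n) \<times> (real^'n) \<times> (real^'n)"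

definition C_set :: "'n::finite dist_system \<Rightarrow> nat \<Rightarrow> (real \<times> (real^'n) \<times> 'n node_vars) set" where
  "C_set D t = {(pA, pS, pD, qD, pG, qG, qS, pN, qN).
     (\<forall>i\<in>loads D. PD_lo D i t \<le> pD $ i \<and> pD $ i \<le> PD_hi D i t \<and> qD $ i = eta_D D i t * pD $ i) \<and>
     (\<forall>i. i \<notin> loads D \<longrightarrow> pD $ i = 0 \<and> qD $ i = 0) \<and>
     (\<forall>i\<in>gens D. PG_lo D i t \<le> pG $ i \<and> pG $ i \<le> PG_hi D i t \<and>
        (pG $ i)\<^sup>2 + (qG $ i)\<^sup>2 \<le> (SG_hi D i t)\<^sup>2) \<and>
     (\<forall>i. i \<notin> gens D \<longrightarrow> pG $ i = 0 \<and> qG $ i = 0) \<and>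
     (\<forall>i\<in>storages D. - PSC_hi D i \<le> pS $ i \<and> pS $ i \<le> PSD_hi D i \<and>
        (pS $ i)\<^sup>2 + (qS $ i)\<^sup>2 \<le> (SS_hi D i)\<^sup>2) \<and>
     (\<forall>i. i \<notin> storages D \<longrightarrow> pS $ i = 0 \<and> qS $ i = 0) \<and>
     (\<forall>i. pN $ i = pG $ i + pS $ i - pD $ i \<and> qN $ i = qG $ i + qS $ i - qD $ i) \<and>
     pA = pN $ root D \<and>
     (pN, qN) \<in> C_N D}"

definition wf_system :: "'n::finite dist_system \<Rightarrow> bool" where
  "wf_system D \<longleftrightarrow>
     1 \<le> horizon D \<and> 0 < tau D \<and>
     (\<forall>i\<in>storages D. 0 < PSD_hi D i \<and> 0 < PSC_hi D i \<and>
        kappa D i \<in> {0<..1} \<and> eta_SD D i \<in> {0<..1} \<and> eta_SC D i \<in> {0<..1}) \<and>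
     convex (C_N D) \<and>
     (\<forall>t\<in>{1..horizon D}. convex (C_set D t) \<and> closed (C_set D t))"

definition energy_out :: "'n::finite dist_system \<Rightarrow> 'n \<Rightarrow> real \<Rightarrow> real" where
  "energy_out D i p = max p 0 * tau D / eta_SD D i + min p 0 * tau D * eta_SC D i"

definition OC :: "'n::finite dist_system \<Rightarrow> nat \<Rightarrow> real^'n \<Rightarrow> real \<Rightarrow> real^'n \<Rightarrow> real^'n \<Rightarrow> 'n node_vars \<Rightarrow> bool" where
  "OC D t e_prev pA e pS y \<longleftrightarrow>
     (pA, pS, y) \<in> C_set D t \<and>
     (\<forall>i\<in>storages D. e $ i = kappa D i * e_prev $ i - energy_out D i (pS $ i) \<and>
        E_lo D i \<le> e $ i \<and> e $ i \<le> E_hi D i)"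

text \<open>
  \<open>stages D v w k\<close> is the part of the alternating quantifier prefix belonging to the last \<open>k\<close>
  periods, followed by the operational constraints of all periods.  The remaining arguments are
  the trajectories of the aggregate power, stored energy, storage power and node variables, in
  which the quantified values are recorded.
\<close>

primrec stages :: "'n::finite dist_system \<Rightarrow> (nat \<Rightarrow> real) \<Rightarrow> (nat \<Rightarrow> real) \<Rightarrow> nat \<Rightarrow>
    (nat \<Rightarrow> real) \<Rightarrow> (nat \<Rightarrow> real^'n) \<Rightarrow> (nat \<Rightarrow> real^'n) \<Rightarrow> (nat \<Rightarrow> 'n node_vars) \<Rightarrow> bool" where
  "stages D v w 0 pA e pS y \<longleftrightarrow>
     (\<forall>t\<in>{1..horizon D}. OC D t (e (t - 1)) (pA t) (e t) (pS t) (y t))"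
| "stages D v w (Suc k) pA e pS y \<longleftrightarrow>
     (let t = horizon D - k in
      \<forall>a\<in>{v t..w t}. \<exists>e' p' y'.
        stages D v w k (pA(t := a)) (e(t := e')) (pS(t := p')) (y(t := y')))"

text \<open>
  The space of real vectors indexed by the periods is the set of functions on \<open>{1..T}\<close> that are
  \<open>undefined\<close> elsewhere, so a feasible point carries no data beyond the horizon that an objective
  could depend on.  The initial trajectories in \<open>multistage_feasible\<close> matter only through
  the value \<open>e0\<close> at period 0; all their values at later periods are overwritten.
\<close>

definition multistage_feasible :: "'n::finite dist_system \<Rightarrow> (nat \<Rightarrow> real) \<Rightarrow> (nat \<Rightarrow> real) \<Rightarrow> bool" where
  "multistage_feasible D v w \<longleftrightarrow>
     v \<in> {1..horizon D} \<rightarrow>\<^sub>E UNIV \<and> w \<in> {1..horizon D} \<rightarrow>\<^sub>E UNIV \<and>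
     (\<forall>t\<in>{1..horizon D}. v t \<le> w t) \<and>
     stages D v w (horizon D) (\<lambda>_. 0) (\<lambda>_. e0 D) (\<lambda>_. 0) (\<lambda>_. 0)"

definition rectangular_feasible :: "'n::finite dist_system \<Rightarrow> (nat \<Rightarrow> real) \<Rightarrow> (nat \<Rightarrow> real) \<Rightarrow>
    (nat \<Rightarrow> real^'n) \<Rightarrow> (nat \<Rightarrow> real^'n) \<Rightarrow> bool" where
  "rectangular_feasible D v w el eu \<longleftrightarrow>
     v \<in> {1..horizon D} \<rightarrow>\<^sub>E UNIV \<and> w \<in> {1..horizon D} \<rightarrow>\<^sub>E UNIV \<and>
     (\<forall>t\<in>{1..horizon D}. v t \<le> w t) \<and>
     (\<forall>i\<in>storages D. el 0 $ i \<le> e0 D $ i \<and> e0 D $ i \<le> eu 0 $ i) \<and>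
     (\<forall>i\<in>storages D. \<forall>t\<in>{0..horizon D}.
        E_lo D i \<le> el t $ i \<and> el t $ i \<le> eu t $ i \<and> eu t $ i \<le> E_hi D i) \<and>
     (\<forall>t\<in>{1..horizon D}. \<forall>e_prev.
        (\<forall>i\<in>storages D. e_prev $ i \<in> {el (t - 1) $ i..eu (t - 1) $ i}) \<longrightarrow>
        (\<exists>ev pv yv ew pw yw.
           (v t, pv, yv) \<in> C_set D t \<and> (w t, pw, yw) \<in> C_set D t \<and>
           (\<forall>i\<in>storages D.
              ev $ i \<in> {el t $ i..eu t $ i} \<and> ew $ i \<in> {el t $ i..eu t $ i} \<and>
              ev $ i = kappa D i * e_prev $ i - energy_out D i (pv $ i) \<and>
              ew $ i = kappa D i * e_prev $ i - energy_out D i (pw $ i))))"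

definition multistage_value ::
    "'n::finite dist_system \<Rightarrow> ((nat \<Rightarrow> real) \<Rightarrow> (nat \<Rightarrow> real) \<Rightarrow> real) \<Rightarrow> ereal" where
  "multistage_value D \<phi> = (SUP (v, w) \<in> {(v, w). multistage_feasible D v w}. ereal (\<phi> v w))"

definition rectangular_value ::
    "'n::finite dist_system \<Rightarrow> ((nat \<Rightarrow> real) \<Rightarrow> (nat \<Rightarrow> real) \<Rightarrow> real) \<Rightarrow> ereal" where
  "rectangular_value D \<phi> =
     (SUP (v, w, el, eu) \<in> {(v, w, el, eu). rectangular_feasible D v w el eu}. ereal (\<phi> v w))"

end

theory Submission
  imports Defs
begin

text \<open>
  The boxes between \<open>el t\<close> and \<open>eu t\<close> are invariant: from any stored energy in
  the box of period \<open>t - 1\<close>, every aggregate power between the two bounds leads into the box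
  of period \<open>t\<close>.  Interpolating between the two decisions given for the bounds stays in
  \<open>C_set D t\<close> by convexity.  The energy drawn from a storage is nonlinear but monotone in its
  power, so the resulting stored energy lies between the two endpoint energies and hence in the box.
\<close>

lemma mono_energy_out:
  assumes "0 \<le> tau D" "0 \<le> eta_SD D i" "0 \<le> eta_SC D i"
  shows "mono (energy_out D i)"
  unfolding energy_out_def
  by (intro monoI add_mono mult_right_mono divide_right_mono max.mono min.mono order_refl assms)

text \<open>With \<open>k\<close> periods left, the invariant keeps the current energy in
  \<open>B\<close>, so \<open>step\<close> answers every aggregate power. \<open>stages\<close>
  tests the constraints only after the last choice, hence the hypothesis that all decided periods
  already satisfy them.\<close>

lemma stages_invariant:
  assumes step: "\<And>t e a. \<lbrakk>t \<in> {1..horizon D}; a \<in> {v t..w t}; e \<in> B (t - 1)\<rbrakk>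
      \<Longrightarrow> \<exists>e'\<in>B t. \<exists>p y. OC D t e a e' p y"
    and "k \<le> horizon D"
    and "e (horizon D - k) \<in> B (horizon D - k)"
    and "\<forall>t\<in>{1..horizon D - k}. OC D t (e (t - 1)) (pA t) (e t) (pS t) (y t)"
  shows "stages D v w k pA e pS y"
  using assms(2-)
proof (induction k arbitrary: pA e pS y)
  case 0
  then show ?case by simp
next
  case (Suc k)
  \<comment> \<open>The period of the outermost quantifier pair. It is at least 1, so the truncated
    \<open>t - 1\<close> is the true predecessor.\<close>
  define t where "t = horizon D - k"
  have t: "t \<in> {1..horizon D}" and t_pred: "horizon D - Suc k = t - 1"
    using Suc.prems(1) by (auto simp: t_def)
  have "\<exists>e' p' y'. stages D v w k (pA(t := a)) (e(t := e')) (pS(t := p')) (y(t := y'))"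
    if a: "a \<in> {v t..w t}" for a
  proof -
    obtain e' p' y' where e': "e' \<in> B t" and oc: "OC D t (e (t - 1)) a e' p' y'"
      using step[OF t a] Suc.prems(2) t_pred by metis
    have "stages D v w k (pA(t := a)) (e(t := e')) (pS(t := p')) (y(t := y'))"
    proof (rule Suc.IH)
      show "k \<le> horizon D"
        using Suc.prems(1) by simp
      show "(e(t := e')) (horizon D - k) \<in> B (horizon D - k)"
        using e' by (simp add: t_def)
      show "\<forall>s\<in>{1..horizon D - k}. OC D s ((e(t := e')) (s - 1)) ((pA(t := a)) s)
          ((e(t := e')) s) ((pS(t := p')) s) ((y(t := y')) s)"
      proof
        fix s assume s: "s \<in> {1..horizon D - k}"
        show "OC D s ((e(t := e')) (s - 1)) ((pA(t := a)) s)
          ((e(t := e')) s) ((pS(t := p')) s) ((y(t := y')) s)"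
        \<comment> \<open>For \<open>s = t\<close> the energy at \<open>t - 1\<close> is untouched
          by the update. For earlier \<open>s\<close> neither \<open>s\<close> nor
          \<open>s - 1\<close> equals \<open>t\<close>, so the old constraints carry over.\<close>
        proof (cases "s = t")
          case True
          then show ?thesis using oc t by auto
        next
          case False
          then have "s \<in> {1..horizon D - Suc k}" "s - 1 \<noteq> t"
            using s t_pred by (auto simp: t_def)
          then show ?thesis using Suc.prems(3) False by simp
        qed
      qed
    qed
    then show ?thesis by blast
  qed
  then show ?case by (simp add: Let_def t_def)
qed

lemma convex_C_set_interpolate:
  fixes pv pw :: "real^'n::finite" and a :: real
  assumes "convex (C_set D t)"
    and "(l, pv, yv) \<in> C_set D t" "(u, pw, yw) \<in> C_set D t"
    and "a \<in> {l..u}"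
  obtains p y where "(a, p, y) \<in> C_set D t"
    and "\<And>i. min (pv $ i) (pw $ i) \<le> p $ i \<and> p $ i \<le> max (pv $ i) (pw $ i)"
proof -
  \<comment> \<open>The segment supplies the weight without dividing by \<open>u - l\<close>, which
    may be 0.\<close>
  have "a \<in> closed_segment l u"
    using assms(4) by (simp add: closed_segment_eq_real_ivl)
  then obtain c where c: "0 \<le> c" "c \<le> 1" and a: "a = (1 - c) * l + c * u"
    by (auto simp: closed_segment_def)
  let ?p = "(1 - c) *\<^sub>R pv + c *\<^sub>R pw"
  let ?y = "(1 - c) *\<^sub>R yv + c *\<^sub>R yw"
  have "(1 - c) *\<^sub>R (l, pv, yv) + c *\<^sub>R (u, pw, yw) \<in> C_set D t"
    using assms(1-3) c by (intro convexD) auto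
  then have "(a, ?p, ?y) \<in> C_set D t"
    by (simp add: a)
  moreover have "min (pv $ i) (pw $ i) \<le> ?p $ i \<and> ?p $ i \<le> max (pv $ i) (pw $ i)" for i
  proof -
    have "?p $ i \<in> closed_segment (pv $ i) (pw $ i)"
      using c by (auto simp: closed_segment_def)
    then show ?thesis
      by (auto simp: closed_segment_eq_real_ivl split: if_splits)
  qed
  ultimately show ?thesis by (rule that)
qed

text \<open>The two endpoint decisions depend only on \<open>e\<close>; their mixing weight is fixed
  once \<open>a\<close> is revealed. The answer thus uses no future information, as the quantifier
  order demands.\<close>

lemma rectangular_step:
  assumes wf: "wf_system D" and rect: "rectangular_feasible D v w el eu"
    and t: "t \<in> {1..horizon D}" and a: "a \<in> {v t..w t}"
    and e: "\<forall>i\<in>storages D. e $ i \<in> {el (t - 1) $ i..eu (t - 1) $ i}"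
  shows "\<exists>e'. (\<forall>i\<in>storages D. e' $ i \<in> {el t $ i..eu t $ i}) \<and> (\<exists>p y. OC D t e a e' p y)"
proof -
  have "\<exists>ev pv yv ew pw yw.
      (v t, pv, yv) \<in> C_set D t \<and> (w t, pw, yw) \<in> C_set D t \<and>
      (\<forall>i\<in>storages D.
        ev $ i \<in> {el t $ i..eu t $ i} \<and> ew $ i \<in> {el t $ i..eu t $ i} \<and>
        ev $ i = kappa D i * e $ i - energy_out D i (pv $ i) \<and>
        ew $ i = kappa D i * e $ i - energy_out D i (pw $ i))"
    using rect[unfolded rectangular_feasible_def, THEN conjunct2, THEN conjunct2,
        THEN conjunct2, THEN conjunct2, THEN conjunct2, THEN bspec, OF t, THEN spec, THEN mp, OF e] .
  then obtain ev pv yv ew pw yw where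
    C: "(v t, pv, yv) \<in> C_set D t" "(w t, pw, yw) \<in> C_set D t" and
    E: "\<forall>i\<in>storages D.
      ev $ i \<in> {el t $ i..eu t $ i} \<and> ew $ i \<in> {el t $ i..eu t $ i} \<and>
      ev $ i = kappa D i * e $ i - energy_out D i (pv $ i) \<and>
      ew $ i = kappa D i * e $ i - energy_out D i (pw $ i)"
    by (elim exE conjE)
  have "convex (C_set D t)"
    using wf t by (simp add: wf_system_def)
  then obtain p y where p: "(a, p, y) \<in> C_set D t"
    and between: "\<And>i. min (pv $ i) (pw $ i) \<le> p $ i \<and> p $ i \<le> max (pv $ i) (pw $ i)"
    using convex_C_set_interpolate[OF _ C a] by blast
  \<comment> \<open>The dynamics force this choice: mixing \<open>ev\<close> and \<open>ew\<close>
    would in general violate them, as \<open>energy_out\<close> is not linear.\<close>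
  define e' where "e' = (\<chi> i. kappa D i * e $ i - energy_out D i (p $ i))"
  have box: "e' $ i \<in> {el t $ i..eu t $ i}" if i: "i \<in> storages D" for i
  proof -
    have mono: "mono (energy_out D i)"
      using wf i by (intro mono_energy_out) (auto simp: wf_system_def intro: less_imp_le)
    \<comment> \<open>A monotone map commutes with \<open>min\<close> and \<open>max\<close>, so the
      order of the two endpoint powers, which may differ between storages, does not matter.\<close>
    have "min (energy_out D i (pv $ i)) (energy_out D i (pw $ i)) \<le> energy_out D i (p $ i)"
      using monoD[OF mono, of "min (pv $ i) (pw $ i)" "p $ i"] between[of i]
      by (simp add: min_of_mono[OF mono])
    moreover have "energy_out D i (p $ i) \<le> max (energy_out D i (pv $ i)) (energy_out D i (pw $ i))"
      using monoD[OF mono, of "p $ i" "max (pv $ i) (pw $ i)"] between[of i]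
      by (simp add: max_of_mono[OF mono])
    moreover have "ev $ i \<in> {el t $ i..eu t $ i}" "ew $ i \<in> {el t $ i..eu t $ i}"
      "ev $ i = kappa D i * e $ i - energy_out D i (pv $ i)"
      "ew $ i = kappa D i * e $ i - energy_out D i (pw $ i)"
      "e' $ i = kappa D i * e $ i - energy_out D i (p $ i)"
      using bspec[OF E i] unfolding e'_def vec_lambda_beta by blast+
    ultimately show ?thesis
      unfolding atLeastAtMost_iff by linarith
  qed
  have "E_lo D i \<le> e' $ i \<and> e' $ i \<le> E_hi D i" if "i \<in> storages D" for i
  proof -
    have "E_lo D i \<le> el t $ i" "eu t $ i \<le> E_hi D i"
      using rect t that by (simp_all add: rectangular_feasible_def)
    then show ?thesis using box[OF that] by simp
  qed
  then have "OC D t e a e' p y"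
    using p by (simp add: OC_def e'_def)
  then show ?thesis using box by blast
qed

lemma rectangular_imp_multistage:
  assumes "wf_system D" "rectangular_feasible D v w el eu"
  shows "multistage_feasible D v w"
proof -
  let ?B = "\<lambda>t. {e. \<forall>i\<in>storages D. e $ i \<in> {el t $ i..eu t $ i}}"
  have "stages D v w (horizon D) (\<lambda>_. 0) (\<lambda>_. e0 D) (\<lambda>_. 0) (\<lambda>_. 0)"
  proof (rule stages_invariant[where B = ?B])
    show "\<exists>e'\<in>?B t. \<exists>p y. OC D t e a e' p y"
      if "t \<in> {1..horizon D}" "a \<in> {v t..w t}" "e \<in> ?B (t - 1)" for t e a
      using rectangular_step[OF assms that(1,2), of e] that(3) by simp
    \<comment> \<open>Before the first period the index is 0 and no constraint has yet been
      decided.\<close>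
    show "e0 D \<in> ?B (horizon D - horizon D)"
      using assms(2) by (simp add: rectangular_feasible_def)
  qed simp_all
  then show ?thesis
    using assms(2) by (simp add: rectangular_feasible_def multistage_feasible_def)
qed

theorem corollary3:
  fixes D :: "'n::finite dist_system"
    and \<phi> :: "(nat \<Rightarrow> real) \<Rightarrow> (nat \<Rightarrow> real) \<Rightarrow> real"
  assumes "wf_system D"
  shows "(\<forall>v w el eu. rectangular_feasible D v w el eu \<longrightarrow> multistage_feasible D v w) \<and>
         rectangular_value D \<phi> \<le> multistage_value D \<phi>"
proof
  show feasible: "\<forall>v w el eu. rectangular_feasible D v w el eu \<longrightarrow> multistage_feasible D v w"
    using rectangular_imp_multistage[OF assms] by blast
  \<comment> \<open>Dropping the energy bounds maps feasible points to feasible points with the same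
    objective value. If there are none, the left side is the supremum of the empty set, the least
    element of \<open>ereal\<close>.\<close>
  show "rectangular_value D \<phi> \<le> multistage_value D \<phi>"
    unfolding rectangular_value_def multistage_value_def
  proof (rule SUP_least, clarify)
    fix v w el eu
    assume "rectangular_feasible D v w el eu"
    then have "(v, w) \<in> {(v, w). multistage_feasible D v w}"
      using feasible by blast
    from SUP_upper[OF this, of "\<lambda>(v, w). ereal (\<phi> v w)"]
    show "ereal (\<phi> v w) \<le> (SUP (v, w) \<in> {(v, w). multistage_feasible D v w}. ereal (\<phi> v w))"
      by simp
  qed
qed

end
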